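(* Let $\mathbf{P}=(p_1,\dots,p_n)$, $n\ge 3$, be an ideal hyperbolic polygon with sides $\xi_1,\dots,\xi_n$, and let $$S_{\mathbf{P}}=\left(\frac{I_{\mathbf{P}}-K_{\mathbf{P}}}{I_{\mathbf{P}}+K_{\mathbf{P}}},\ \frac{2J_{\mathbf{P}}}{I_{\mathbf{P}}+K_{\mathbf{P}}}\right).$$ Then $S_{\mathbf{P}}$ minimizes the sum of the hyperbolic sines of the hyperbolic distances to the sides of $\mathbf{P}$, i.e. $X=S_{\mathbf{P}}$ minimizes $\sum_{\ell=1}^{n}\sinh\bigl(d_{\mathcal K}(X,\xi_\ell)\bigr)$.
   Context: $\mathbb{H}$ is the open unit disc with the Klein–Beltrami metric $d_{\mathcal K}(X,Y)=\cosh^{-1}\frac{1-X\cdot Y}{\sqrt{(1-|X|^2)(1-|Y|^2)}}$; geodesics are the open chords, and $d_{\mathcal K}(X,\xi)$ is the hyperbolic distance from $X$ to the geodesic $\xi$. The unit circle is identified with $\mathbb{RP}^1=\mathbb{R}\cup\{\infty\}$ by $p\mapsto P=\left(\frac{1-p^2}{1+p^2},\frac{2p}{1+p^2}\right)$, $\infty\mapsto(-1,0)$. An ideal $n$-gon $\mathbf{P}=(p_1,\dots,p_n)$ is given by pairwise distinct points $p_\ell\in\mathbb{RP}^1$; its vertices are the corresponding points $P_\ell$ and its sides are the geodesics $\xi_\ell=P_\ell P_{\ell+1}$ (indices modulo $n$). Further $$I_{\mathbf{P}}=\sum_{\ell=1}^n\frac{1}{p_\ell-p_{\ell+1}},\quad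 J_{\mathbf{P}}=\frac12\sum_{\ell=1}^n\frac{p_\ell+p_{\ell+1}}{p_\ell-p_{\ell+1}},\quad K_{\mathbf{P}}=\sum_{\ell=1}^n\frac{p_\ell p_{\ell+1}}{p_\ell-p_{\ell+1}},$$ where, if one of the $p_\ell$ is $\infty$, each summand is replaced by its limit. The formula for $S_{\mathbf{P}}$ makes sense when $I_{\mathbf{P}}+K_{\mathbf{P}}\ne0$, which holds generically, and always when $\mathbf{P}$ is convex. The point $S_{\mathbf{P}}$ is called the hyperbolic barycenter of $\mathbf{P}$.
   Formalization: For non-convex polygons the claim with unsigned distances can fail (e.g. P=(-3,-1,1,3,0)); it is proved with unsigned distances for convex P, and with signed distances for any P with I+K nonzero and S_P inside the disc. *)

theory Defs
  imports "HOL-Analysis.Analysis" "HOL-Real_Asymp.Real_Asymp"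
begin

section \<open>The Klein--Beltrami model\<close>

definition klein_disc :: "(real \<times> real) set" where
  "klein_disc = ball 0 1"

definition klein_dist :: "real \<times> real \<Rightarrow> real \<times> real \<Rightarrow> real" where
  "klein_dist X Y =
     arcosh ((1 - X \<bullet> Y) / sqrt ((1 - (norm X)\<^sup>2) * (1 - (norm Y)\<^sup>2)))"

definition klein_setdist :: "real \<times> real \<Rightarrow> (real \<times> real) set \<Rightarrow> real" where
  "klein_setdist X \<xi> = (INF Y\<in>\<xi>. klein_dist X Y)"

text \<open>Positive if and only if \<open>X\<close> lies to the left of the line directed from \<open>P\<close> to \<open>Q\<close>.\<close>

definition orient :: "real \<times> real \<Rightarrow> real \<times> real \<Rightarrow> real \<times> real \<Rightarrow> real" where
  "orient P Q X =
     (fst Q - fst P) * (snd X - snd P) - (snd Q - snd P) * (fst X - fst P)"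

section \<open>Ideal polygons\<close>

text \<open>The real projective line is the type \<^typ>\<open>real option\<close>, with \<^const>\<open>None\<close> as the point
  at infinity.\<close>

fun circle_point :: "real option \<Rightarrow> real \<times> real" where
  "circle_point (Some p) = ((1 - p\<^sup>2) / (1 + p\<^sup>2), 2 * p / (1 + p\<^sup>2))"
| "circle_point None = (-1, 0)"

text \<open>An \<open>n\<close>-gon is given by the values of \<open>p\<close> on \<open>{..<n}\<close>; vertices and sides are
  numbered from \<open>0\<close>.\<close>

definition ideal_polygon :: "nat \<Rightarrow> (nat \<Rightarrow> real option) \<Rightarrow> bool" where
  "ideal_polygon n p \<longleftrightarrow> inj_on p {..<n}"

definition next_vertex :: "nat \<Rightarrow> nat \<Rightarrow> nat" where
  "next_vertex n l = Suc l mod n"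

definition side :: "nat \<Rightarrow> (nat \<Rightarrow> real option) \<Rightarrow> nat \<Rightarrow> (real \<times> real) set" where
  "side n p l = open_segment (circle_point (p l)) (circle_point (p (next_vertex n l)))"

text \<open>Every side line has all the vertices in one of its two closed half-planes.\<close>

definition convex_polygon :: "nat \<Rightarrow> (nat \<Rightarrow> real option) \<Rightarrow> bool" where
  "convex_polygon n p \<longleftrightarrow>
     (\<forall>l<n. let h = (\<lambda>k. orient (circle_point (p l)) (circle_point (p (next_vertex n l)))
                               (circle_point (p k)))
            in (\<forall>k<n. 0 \<le> h k) \<or> (\<forall>k<n. h k \<le> 0))"

section \<open>The hyperbolic barycenter\<close>

text \<open>In each summand, an argument equal to infinity is replaced by the limit; see the
  lemmas below. The value at two infinite arguments is irrelevant, since the vertices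
  of an ideal polygon are distinct.\<close>

fun I_term :: "real option \<Rightarrow> real option \<Rightarrow> real" where
  "I_term (Some p) (Some q) = 1 / (p - q)"
| "I_term None (Some q) = 0"
| "I_term (Some p) None = 0"
| "I_term None None = 0"

fun J_term :: "real option \<Rightarrow> real option \<Rightarrow> real" where
  "J_term (Some p) (Some q) = (p + q) / (p - q)"
| "J_term None (Some q) = 1"
| "J_term (Some p) None = - 1"
| "J_term None None = 0"

fun K_term :: "real option \<Rightarrow> real option \<Rightarrow> real" where
  "K_term (Some p) (Some q) = (p * q) / (p - q)"
| "K_term None (Some q) = q"
| "K_term (Some p) None = - p"
| "K_term None None = 0"

lemma I_term_limits:
  "((\<lambda>p. I_term (Some p) (Some q)) \<longlongrightarrow> I_term None (Some q)) at_infinity"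
  "((\<lambda>q. I_term (Some p) (Some q)) \<longlongrightarrow> I_term (Some p) None) at_infinity"
  unfolding at_infinity_eq_at_top_bot by (auto intro!: filterlim_sup; real_asymp)+

lemma J_term_limits:
  "((\<lambda>p. J_term (Some p) (Some q)) \<longlongrightarrow> J_term None (Some q)) at_infinity"
  "((\<lambda>q. J_term (Some p) (Some q)) \<longlongrightarrow> J_term (Some p) None) at_infinity"
  unfolding at_infinity_eq_at_top_bot by (auto intro!: filterlim_sup; real_asymp)+

lemma K_term_limits:
  "((\<lambda>p. K_term (Some p) (Some q)) \<longlongrightarrow> K_term None (Some q)) at_infinity"
  "((\<lambda>q. K_term (Some p) (Some q)) \<longlongrightarrow> K_term (Some p) None) at_infinity"
  unfolding at_infinity_eq_at_top_bot by (auto intro!: filterlim_sup; real_asymp)+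

definition I_sum :: "nat \<Rightarrow> (nat \<Rightarrow> real option) \<Rightarrow> real" where
  "I_sum n p = (\<Sum>l<n. I_term (p l) (p (next_vertex n l)))"

definition J_sum :: "nat \<Rightarrow> (nat \<Rightarrow> real option) \<Rightarrow> real" where
  "J_sum n p = (1 / 2) * (\<Sum>l<n. J_term (p l) (p (next_vertex n l)))"

definition K_sum :: "nat \<Rightarrow> (nat \<Rightarrow> real option) \<Rightarrow> real" where
  "K_sum n p = (\<Sum>l<n. K_term (p l) (p (next_vertex n l)))"

text \<open>Meaningful only if \<open>I_sum n p + K_sum n p \<noteq> 0\<close>.\<close>

definition hyp_barycenter :: "nat \<Rightarrow> (nat \<Rightarrow> real option) \<Rightarrow> real \<times> real" where
  "hyp_barycenter n p =
     ((I_sum n p - K_sum n p) / (I_sum n p + K_sum n p),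
      2 * J_sum n p / (I_sum n p + K_sum n p))"

section \<open>The sum of the hyperbolic sines of the distances to the sides\<close>

definition sinh_dist_sum :: "nat \<Rightarrow> (nat \<Rightarrow> real option) \<Rightarrow> real \<times> real \<Rightarrow> real" where
  "sinh_dist_sum n p X = (\<Sum>l<n. sinh (klein_setdist X (side n p l)))"

text \<open>For a polygon that is not convex, the distances have to be taken with signs. Traversing
  the polygon directs its sides, and distances are positive on the left of every side or
  on the right of every side. Reversing the traversal changes the sign of \<open>I\<close>,
  \<open>J\<close>, \<open>K\<close> and exchanges left and right, but does not change the
  barycenter; the positive sides are the left ones if \<open>I + K < 0\<close>, which is the case for a
  convex polygon traversed counterclockwise, and the right ones if \<open>I + K > 0\<close>.
  In particular, the distances are positive in the interior of a convex polygon.\<close>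

definition signed_side_dist :: "nat \<Rightarrow> (nat \<Rightarrow> real option) \<Rightarrow> nat \<Rightarrow> real \<times> real \<Rightarrow> real" where
  "signed_side_dist n p l X =
     - sgn (I_sum n p + K_sum n p) *
     sgn (orient (circle_point (p l)) (circle_point (p (next_vertex n l))) X) *
     klein_setdist X (side n p l)"

definition signed_sinh_dist_sum ::
    "nat \<Rightarrow> (nat \<Rightarrow> real option) \<Rightarrow> real \<times> real \<Rightarrow> real" where
  "signed_sinh_dist_sum n p X = (\<Sum>l<n. sinh (signed_side_dist n p l X))"

end

theory Submission
  imports Defs
begin

text \<open>
  Embed the disc in Minkowski space by \<open>X \<mapsto> (1, X) / sqrt (1 - |X|\<^sup>2)\<close>. A geodesic is the zero set
  of a linear form given by a unit spacelike vector \<open>N\<close>, and the hyperbolic sine of the signed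
  distance from \<open>X\<close> to it is the value of this form at the embedded point. For the side from
  \<open>p\<close> to \<open>q\<close>, the form has the coefficients \<open>- (I + K)\<close>, \<open>I - K\<close> and
  \<open>2 J\<close>, where \<open>I\<close>, \<open>J\<close>, \<open>K\<close> are the
  summands of the three sums at this side, with the factor \<open>1 / 2\<close> in \<open>J\<close> (\<open>orient_side_form\<close>,
  \<open>sinh_klein_setdist_chord\<close>). Hence the sum of the signed hyperbolic sines is again a linear
  form at the embedded point, and its value is \<open>|I + K| (1 - S \<bullet> X) / sqrt (1 - |X|\<^sup>2)\<close> with the
  total sums \<open>I\<close> and \<open>K\<close> and the barycenter \<open>S\<close>
  (\<open>signed_sinh_dist_sum_eq\<close>). If \<open>|S| < 1\<close>, this is minimal at \<open>X = S\<close>, by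
  the reversed Cauchy-Schwarz inequality for timelike vectors.

  The unsigned sum is at least the signed one, so for a convex polygon it remains to show that
  \<open>S\<close> lies in the disc and inside the polygon, where both sums agree. The unit normals of two
  sides of a convex polygon that both point inwards have Minkowski product at most \<open>-1\<close>
  (\<open>side_gram_le\<close>): it is expressed by a cross ratio of the four end points, whose sign records
  that the sides do not cross. So the product of a normal with the sum \<open>V\<close> of all \<open>n\<close> normals
  is at most \<open>1 - (n - 1) < 0\<close> (\<open>convex_sum_side_gram_neg\<close>). Summing these products shows that
  \<open>V\<close> is timelike, that is, \<open>|S| < 1\<close>; and individually they say that \<open>S\<close>, for which
  \<open>(1, S)\<close> spans the same line as \<open>V\<close>, lies on the inner side of every side.
\<close>

section \<open>The distance from a point to a geodesic\<close>

text \<open>Up to sign, both sides are the Gram determinant of the vectors \<open>(1, P)\<close>, \<open>(1, Q)\<close>, \<open>(1, X)\<close> in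
  Minkowski space, two of which are null vectors.\<close>

lemma orient_square:
  assumes "norm P = 1" "norm Q = 1"
  shows "(orient P Q X)\<^sup>2 =
    2 * (1 - X \<bullet> P) * (1 - X \<bullet> Q) * (1 - P \<bullet> Q) - (1 - P \<bullet> Q)\<^sup>2 * (1 - (norm X)\<^sup>2)"
proof -
  obtain a b c d x y where eq: "P = (a, b)" "Q = (c, d)" "X = (x, y)"
    by (metis surj_pair)
  have "(norm P)\<^sup>2 = 1" "(norm Q)\<^sup>2 = 1" using assms by simp_all
  then have "a\<^sup>2 + b\<^sup>2 = 1" "c\<^sup>2 + d\<^sup>2 = 1"
    by (simp_all add: eq norm_Pair)
  then have "((c - a) * (y - b) - (d - b) * (x - a))\<^sup>2 =
    2 * (1 - (x * a + y * b)) * (1 - (x * c + y * d)) * (1 - (a * c + b * d))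
    - (1 - (a * c + b * d))\<^sup>2 * (1 - (x\<^sup>2 + y\<^sup>2))"
    by algebra
  then show ?thesis
    by (simp add: eq orient_def norm_Pair)
qed

lemma inner_less_1:
  fixes P Q :: "'a::real_inner"
  assumes "norm P = 1" "norm Q = 1" "P \<noteq> Q"
  shows "P \<bullet> Q < 1"
proof -
  have "(norm (P - Q))\<^sup>2 = 2 - 2 * (P \<bullet> Q)"
    using assms by (simp add: power2_norm_eq_inner inner_diff inner_commute norm_eq_1)
  moreover have "(norm (P - Q))\<^sup>2 > 0" using assms by simp
  ultimately show ?thesis by simp
qed

lemma inner_less_1_disc:
  fixes P X :: "'a::real_inner"
  assumes "norm P \<le> 1" "norm X < 1"
  shows "X \<bullet> P < 1"
proof -
  have "X \<bullet> P \<le> norm X * norm P" by (rule norm_cauchy_schwarz)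
  also have "\<dots> \<le> norm X * 1" using assms by (intro mult_left_mono) auto
  finally show ?thesis using assms by simp
qed

text \<open>At the point that divides the chord in the ratio \<open>t\<close> to \<open>1 - t\<close>, the hyperbolic cosine
  of the distance from \<open>X\<close> is a constant times
  \<open>((1 - t) * \<alpha> + t * \<beta>) / sqrt (t * (1 - t))\<close>, where \<open>\<alpha> = 1 - X \<bullet> P\<close> and
  \<open>\<beta> = 1 - X \<bullet> Q\<close>. The inequality of the arithmetic and geometric means gives its minimum.\<close>

lemma klein_setdist_chord:
  assumes P: "norm P = 1" and Q: "norm Q = 1" and PQ: "P \<noteq> Q" and X: "norm X < 1"
  defines "m \<equiv> sqrt (2 * (1 - X \<bullet> P) * (1 - X \<bullet> Q) / ((1 - P \<bullet> Q) * (1 - (norm X)\<^sup>2)))"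
  shows "klein_setdist X (open_segment P Q) = arcosh m" and "m \<ge> 1"
proof -
  define \<alpha> \<beta> g N where "\<alpha> = 1 - X \<bullet> P" and "\<beta> = 1 - X \<bullet> Q" and "g = 1 - P \<bullet> Q"
    and "N = 1 - (norm X)\<^sup>2"
  have pos: "\<alpha> > 0" "\<beta> > 0" "g > 0" "N > 0"
    unfolding \<alpha>_def \<beta>_def g_def N_def
    using inner_less_1_disc[of P X] inner_less_1_disc[of Q X] inner_less_1[OF P Q PQ] P Q X
    by (auto simp: abs_square_less_1)
  have m: "m = sqrt (2 * \<alpha> * \<beta> / (g * N))"
    by (simp add: m_def \<alpha>_def \<beta>_def g_def N_def)
  have "g * (2 * \<alpha> * \<beta> - g * N) = (orient P Q X)\<^sup>2"
    using orient_square[OF P Q, of X]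
    unfolding \<alpha>_def \<beta>_def g_def N_def by (simp add: algebra_simps power2_eq_square)
  then have "g * (2 * \<alpha> * \<beta> - g * N) \<ge> 0" by simp
  then have "g * N \<le> 2 * \<alpha> * \<beta>" using pos by (simp add: zero_le_mult_iff)
  then show m1: "m \<ge> 1" using pos by (simp add: m)
  have dist: "klein_dist X ((1 - t) *\<^sub>R P + t *\<^sub>R Q) =
      arcosh (((1 - t) * \<alpha> + t * \<beta>) / sqrt (N * (2 * t * (1 - t) * g)))" for t
  proof -
    have "1 - X \<bullet> ((1 - t) *\<^sub>R P + t *\<^sub>R Q) = (1 - t) * \<alpha> + t * \<beta>"
      by (simp add: \<alpha>_def \<beta>_def inner_simps algebra_simps)
    moreover have "1 - (norm ((1 - t) *\<^sub>R P + t *\<^sub>R Q))\<^sup>2 = 2 * t * (1 - t) * g"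
    proof -
      have "(norm ((1 - t) *\<^sub>R P + t *\<^sub>R Q))\<^sup>2 =
          (1 - t)\<^sup>2 * (P \<bullet> P) + t\<^sup>2 * (Q \<bullet> Q) + 2 * t * (1 - t) * (P \<bullet> Q)"
        unfolding power2_norm_eq_inner
        by (simp add: inner_simps inner_commute power2_eq_square algebra_simps)
      then show ?thesis
        using P Q by (simp add: norm_eq_1 g_def power2_eq_square algebra_simps)
    qed
    ultimately show ?thesis by (simp add: klein_dist_def N_def)
  qed
  have lower: "arcosh m \<le> klein_dist X Y" if "Y \<in> open_segment P Q" for Y
  proof -
    obtain t where t: "0 < t" "t < 1" "Y = (1 - t) *\<^sub>R P + t *\<^sub>R Q"
      using \<open>Y \<in> open_segment P Q\<close> by (auto simp: in_segment)
    define r where "r = ((1 - t) * \<alpha> + t * \<beta>) / sqrt (N * (2 * t * (1 - t) * g))"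
    have den: "N * (2 * t * (1 - t) * g) > 0" using pos t by simp
    have r0: "r > 0" using pos t den by (auto simp: r_def intro!: divide_pos_pos add_pos_pos)
    have "4 * ((1 - t) * \<alpha>) * (t * \<beta>) \<le> ((1 - t) * \<alpha> + t * \<beta>)\<^sup>2"
      using zero_le_power2[of "(1 - t) * \<alpha> - t * \<beta>"] by (simp add: power2_eq_square algebra_simps)
    then have "4 * ((1 - t) * \<alpha>) * (t * \<beta>) * (g * N) \<le> ((1 - t) * \<alpha> + t * \<beta>)\<^sup>2 * (g * N)"
      using pos by (intro mult_right_mono) auto
    moreover have "4 * ((1 - t) * \<alpha>) * (t * \<beta>) * (g * N) =
        2 * \<alpha> * \<beta> * (N * (2 * t * (1 - t) * g))" by algebra
    ultimately have "2 * \<alpha> * \<beta> * (N * (2 * t * (1 - t) * g)) \<le>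
        ((1 - t) * \<alpha> + t * \<beta>)\<^sup>2 * (g * N)" by simp
    then have "2 * \<alpha> * \<beta> / (g * N) \<le> r\<^sup>2"
      using pos den by (simp add: r_def power_divide divide_simps)
    then have "m \<le> r" using r0 by (simp add: m real_le_lsqrt)
    then have "arcosh m \<le> arcosh r"
      using m1 by (cases "m = r") (auto simp: less_imp_le)
    then show ?thesis by (simp add: t dist r_def)
  qed
  \<comment> \<open>The inequality of the means above is sharp when \<open>(1 - t) * \<alpha> = t * \<beta>\<close>.\<close>
  define t where "t = \<alpha> / (\<alpha> + \<beta>)"
  have t: "0 < t" "t < 1" using pos by (auto simp: t_def)
  have t': "1 - t = \<beta> / (\<alpha> + \<beta>)" using pos by (simp add: t_def field_simps)
  have attained: "klein_dist X ((1 - t) *\<^sub>R P + t *\<^sub>R Q) = arcosh m"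
  proof -
    have den: "N * (2 * t * (1 - t) * g) > 0" using pos t by simp
    have "((1 - t) * \<alpha> + t * \<beta>) / sqrt (N * (2 * t * (1 - t) * g)) =
        sqrt (((1 - t) * \<alpha> + t * \<beta>)\<^sup>2 / (N * (2 * t * (1 - t) * g)))"
      using pos t by (simp add: real_sqrt_divide)
    also have "((1 - t) * \<alpha> + t * \<beta>)\<^sup>2 / (N * (2 * t * (1 - t) * g)) = 2 * \<alpha> * \<beta> / (g * N)"
      unfolding t' unfolding t_def using pos
      by (simp add: divide_simps power2_eq_square) (simp add: algebra_simps)?
    finally show ?thesis by (simp add: dist m)
  qed
  have mem: "(1 - t) *\<^sub>R P + t *\<^sub>R Q \<in> open_segment P Q"
    using t PQ by (auto simp: in_segment)
  show "klein_setdist X (open_segment P Q) = arcosh m"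
    unfolding klein_setdist_def
    by (rule cInf_eq_minimum) (use mem attained lower in \<open>auto simp: image_iff intro!: bexI[OF _ mem]\<close>)
qed

lemma sinh_klein_setdist_chord:
  assumes P: "norm P = 1" and Q: "norm Q = 1" and PQ: "P \<noteq> Q" and X: "norm X < 1"
  shows "sinh (klein_setdist X (open_segment P Q)) =
    \<bar>orient P Q X\<bar> / ((1 - P \<bullet> Q) * sqrt (1 - (norm X)\<^sup>2))"
proof -
  define \<alpha> \<beta> g N where "\<alpha> = 1 - X \<bullet> P" and "\<beta> = 1 - X \<bullet> Q" and "g = 1 - P \<bullet> Q"
    and "N = 1 - (norm X)\<^sup>2"
  have pos: "g > 0" "N > 0"
    unfolding g_def N_def using inner_less_1[OF P Q PQ] X by (auto simp: abs_square_less_1)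
  have o: "(orient P Q X)\<^sup>2 = 2 * \<alpha> * \<beta> * g - g\<^sup>2 * N"
    using orient_square[OF P Q, of X] by (simp add: \<alpha>_def \<beta>_def g_def N_def)
  define m where "m = sqrt (2 * \<alpha> * \<beta> / (g * N))"
  have d: "klein_setdist X (open_segment P Q) = arcosh m" and m1: "m \<ge> 1"
    using klein_setdist_chord[OF P Q PQ X] by (simp_all add: m_def \<alpha>_def \<beta>_def g_def N_def)
  from m1 have "2 * \<alpha> * \<beta> / (g * N) \<ge> 0"
    unfolding m_def by (meson order_trans real_sqrt_ge_0_iff zero_le_one)
  then have "m\<^sup>2 = 2 * \<alpha> * \<beta> / (g * N)" by (simp add: m_def)
  then have "m\<^sup>2 - 1 = (2 * \<alpha> * \<beta> * g - g\<^sup>2 * N) / (g\<^sup>2 * N)"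
    using pos by (simp add: divide_simps power2_eq_square) (simp add: algebra_simps)?
  then have "m\<^sup>2 - 1 = (orient P Q X)\<^sup>2 / (g\<^sup>2 * N)"
    by (simp only: o)
  then have "sinh (arcosh m) = sqrt ((orient P Q X)\<^sup>2 / (g\<^sup>2 * N))"
    using m1 by (simp add: sinh_arcosh_real)
  also have "\<dots> = \<bar>orient P Q X\<bar> / (g * sqrt N)"
    using pos by (simp add: real_sqrt_divide real_sqrt_mult)
  finally show ?thesis by (simp add: d g_def N_def)
qed

section \<open>Homogeneous coordinates on the projective line\<close>

text \<open>Homogeneous coordinates treat the point at infinity like the other points. Normalized to
  unit length, they are the cosine and the sine of half the angle of the corresponding
  point of the circle.\<close>

fun proj_coord :: "real option \<Rightarrow> real \<times> real" where
  "proj_coord (Some p) = (1 / sqrt (1 + p\<^sup>2), p / sqrt (1 + p\<^sup>2))"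
| "proj_coord None = (0, 1)"

text \<open>The sine of half the angle between two points of the circle; for finite
  arguments the difference \<open>p - q\<close> up to a positive factor.\<close>

definition bracket :: "real option \<Rightarrow> real option \<Rightarrow> real" where
  "bracket p q = snd (proj_coord p) * fst (proj_coord q) - fst (proj_coord p) * snd (proj_coord q)"

lemma proj_coord_unit: "(fst (proj_coord p))\<^sup>2 + (snd (proj_coord p))\<^sup>2 = 1"
proof (cases p)
  case (Some x)
  have "1 + x\<^sup>2 > 0" by (simp add: add_pos_nonneg)
  then show ?thesis by (simp add: Some power_divide flip: add_divide_distrib)
qed simp

lemma circle_point_proj_coord:
  "circle_point p = ((fst (proj_coord p))\<^sup>2 - (snd (proj_coord p))\<^sup>2,
    2 * fst (proj_coord p) * snd (proj_coord p))"
proof (cases p)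
  case (Some x)
  have "1 + x\<^sup>2 > 0" by (simp add: add_pos_nonneg)
  then show ?thesis by (simp add: Some power_divide diff_divide_distrib)
qed simp

lemma norm_circle_point: "norm (circle_point p) = 1"
proof -
  have "((fst (proj_coord p))\<^sup>2 - (snd (proj_coord p))\<^sup>2)\<^sup>2
      + (2 * fst (proj_coord p) * snd (proj_coord p))\<^sup>2 = 1"
    using proj_coord_unit[of p] by algebra
  then show ?thesis by (simp add: circle_point_proj_coord norm_Pair)
qed

lemma bracket_terms:
  shows "bracket (Some a) (Some b) = (a - b) / (sqrt (1 + a\<^sup>2) * sqrt (1 + b\<^sup>2))"
    and "bracket None (Some b) = 1 / sqrt (1 + b\<^sup>2)"
    and "bracket (Some a) None = - 1 / sqrt (1 + a\<^sup>2)"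
  by (simp_all add: bracket_def diff_divide_distrib)

lemma sqrt_pos: "sqrt (1 + x\<^sup>2) > 0"
  by (simp add: add_pos_nonneg)

lemma bracket_nonzero:
  assumes "p \<noteq> q"
  shows "bracket p q \<noteq> 0"
proof -
  have [simp]: "1 + x\<^sup>2 \<noteq> 0" for x :: real
    using sqrt_pos[of x] by auto
  show ?thesis
    using assms by (cases p; cases q) (auto simp: bracket_terms)
qed

lemma bracket_commute: "bracket q p = - bracket p q"
  by (simp add: bracket_def algebra_simps)

lemma terms_proj_coord:
  assumes "p \<noteq> q"
  shows "I_term p q = fst (proj_coord p) * fst (proj_coord q) / bracket p q"
    and "J_term p q = (snd (proj_coord p) * fst (proj_coord q)
           + fst (proj_coord p) * snd (proj_coord q)) / bracket p q"
    and "K_term p q = snd (proj_coord p) * snd (proj_coord q) / bracket p q"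
proof -
  have [simp]: "1 + x\<^sup>2 \<noteq> 0" for x :: real
    using sqrt_pos[of x] by auto
  show "I_term p q = fst (proj_coord p) * fst (proj_coord q) / bracket p q"
    using assms by (cases p; cases q) (auto simp: bracket_terms)
  show "J_term p q = (snd (proj_coord p) * fst (proj_coord q)
           + fst (proj_coord p) * snd (proj_coord q)) / bracket p q"
    using assms by (cases p; cases q) (auto simp: bracket_terms simp flip: add_divide_distrib)
  show "K_term p q = snd (proj_coord p) * snd (proj_coord q) / bracket p q"
    using assms by (cases p; cases q) (auto simp: bracket_terms)
qed

lemma one_minus_inner_circle_point:
  "1 - circle_point p \<bullet> circle_point q = 2 * (bracket p q)\<^sup>2"
  using proj_coord_unit[of p] proj_coord_unit[of q]
  unfolding circle_point_proj_coord bracket_def inner_prod_def fst_conv snd_conv inner_real_def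
  by algebra

lemma circle_point_inj:
  assumes "p \<noteq> q"
  shows "circle_point p \<noteq> circle_point q"
proof
  assume "circle_point p = circle_point q"
  then have "circle_point p \<bullet> circle_point q = 1"
    using norm_circle_point[of q] by (simp add: norm_eq_1)
  then show False
    using one_minus_inner_circle_point[of p q] bracket_nonzero[OF assms] by simp
qed

text \<open>Twice the signed area of an inscribed triangle; up to sign, the brackets are the sines of its
  angles.\<close>

lemma orient_circle_points:
  "orient (circle_point p) (circle_point q) (circle_point r) =
    4 * bracket p q * bracket q r * bracket r p"
  using proj_coord_unit[of p] proj_coord_unit[of q] proj_coord_unit[of r]
  unfolding circle_point_proj_coord bracket_def orient_def fst_conv snd_conv
  by algebra

section \<open>The unit normal of a side\<close>

text \<open>The form of the unit normal \<open>N\<close> of the side, evaluated at \<open>(1, X)\<close>.\<close>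

definition side_form :: "real option \<Rightarrow> real option \<Rightarrow> real \<times> real \<Rightarrow> real" where
  "side_form p q X = - (I_term p q + K_term p q)
     + (I_term p q - K_term p q) * fst X + J_term p q * snd X"

text \<open>The Minkowski product, positive on spacelike vectors, of the unit normals of two sides.\<close>

definition side_gram ::
    "real option \<Rightarrow> real option \<Rightarrow> real option \<Rightarrow> real option \<Rightarrow> real" where
  "side_gram p q r s = (I_term p q - K_term p q) * (I_term r s - K_term r s)
     + J_term p q * J_term r s - (I_term p q + K_term p q) * (I_term r s + K_term r s)"

lemma orient_side_form:
  assumes "p \<noteq> q"
  shows "orient (circle_point p) (circle_point q) X =
    (1 - circle_point p \<bullet> circle_point q) * side_form p q X"
proof -
  define a b c d x y where "a = fst (proj_coord p)" and "b = snd (proj_coord p)"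
    and "c = fst (proj_coord q)" and "d = snd (proj_coord q)" and "x = fst X" and "y = snd X"
  define w where "w = bracket p q"
  have w: "w \<noteq> 0" "w = b * c - a * d"
    using bracket_nonzero[OF assms] by (simp_all add: w_def bracket_def a_def b_def c_def d_def)
  have u: "a\<^sup>2 + b\<^sup>2 = 1" "c\<^sup>2 + d\<^sup>2 = 1"
    by (simp_all add: a_def b_def c_def d_def proj_coord_unit)
  have "side_form p q X = (- (a * c + b * d) + (a * c - b * d) * x + (b * c + a * d) * y) / w"
  proof -
    have "I_term p q = a * c / w" "J_term p q = (b * c + a * d) / w" "K_term p q = b * d / w"
      by (simp_all add: terms_proj_coord[OF assms] a_def b_def c_def d_def w_def)
    then have "side_form p q X =
        - (a * c / w + b * d / w) + (a * c / w - b * d / w) * x + (b * c + a * d) / w * y"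
      by (simp only: side_form_def x_def y_def)
    then show ?thesis by (simp add: add_divide_distrib diff_divide_distrib algebra_simps)
  qed
  then have "2 * w\<^sup>2 * side_form p q X =
      2 * w * (- (a * c + b * d) + (a * c - b * d) * x + (b * c + a * d) * y)"
    using w(1) by (simp add: power2_eq_square)
  moreover have "orient (circle_point p) (circle_point q) X =
      ((c\<^sup>2 - d\<^sup>2) - (a\<^sup>2 - b\<^sup>2)) * (y - 2 * a * b) - (2 * c * d - 2 * a * b) * (x - (a\<^sup>2 - b\<^sup>2))"
    by (simp add: orient_def circle_point_proj_coord a_def b_def c_def d_def x_def y_def)
  moreover have "((c\<^sup>2 - d\<^sup>2) - (a\<^sup>2 - b\<^sup>2)) * (y - 2 * a * b) - (2 * c * d - 2 * a * b) * (x - (a\<^sup>2 - b\<^sup>2))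
      = 2 * w * (- (a * c + b * d) + (a * c - b * d) * x + (b * c + a * d) * y)"
    using u w(2) by algebra
  ultimately show ?thesis
    unfolding one_minus_inner_circle_point w_def[symmetric] by simp
qed

lemma side_gram_cross_ratio:
  assumes "p \<noteq> q" "r \<noteq> s"
  shows "side_gram p q r s =
    - 1 - 2 * (bracket p s * bracket q r) / (bracket p q * bracket r s)"
proof -
  define w z where "w = bracket p q" and "z = bracket r s"
  have nz: "w \<noteq> 0" "z \<noteq> 0"
    using bracket_nonzero assms by (simp_all add: w_def z_def)
  have "side_gram p q r s * (w * z) = - (w * z) - 2 * (bracket p s * bracket q r)"
    using nz
    unfolding side_gram_def terms_proj_coord[OF assms(1)] terms_proj_coord[OF assms(2)]
      w_def[symmetric] z_def[symmetric]
    by (simp add: field_simps) (simp add: w_def z_def bracket_def algebra_simps)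
  then show ?thesis using nz by (simp add: w_def z_def field_simps)
qed

lemma side_gram_self:
  assumes "p \<noteq> q"
  shows "side_gram p q p q = 1"
  using bracket_nonzero[OF assms] side_gram_cross_ratio[OF assms assms]
  by (simp add: bracket_commute[of q p])

text \<open>The product of the two orientations is the cross ratio in \<open>side_gram_cross_ratio\<close> times a square,
  so the hypothesis says that this cross ratio is nonnegative.\<close>

lemma side_gram_le:
  assumes "p \<noteq> q" "r \<noteq> s" "p \<noteq> r"
    and "orient (circle_point p) (circle_point q) (circle_point r)
       * orient (circle_point r) (circle_point s) (circle_point p) \<ge> 0"
  shows "side_gram p q r s \<le> - 1"
proof -
  define c where "c = (bracket p s * bracket q r) / (bracket p q * bracket r s)"
  have nz: "bracket p q \<noteq> 0" "bracket r s \<noteq> 0" "bracket p r \<noteq> 0"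
    using assms bracket_nonzero by auto
  have "orient (circle_point p) (circle_point q) (circle_point r)
      * orient (circle_point r) (circle_point s) (circle_point p)
      = c * (4 * bracket p q * bracket r s * bracket p r)\<^sup>2"
    unfolding orient_circle_points bracket_commute[of r p] bracket_commute[of s p] c_def
    using nz by (simp add: power2_eq_square)
  then have "c \<ge> 0"
    using assms(4) nz by (simp add: zero_le_mult_iff)
  then show ?thesis
    using side_gram_cross_ratio[OF assms(1,2)] by (simp add: c_def)
qed

section \<open>Sums over the sides of a polygon\<close>

lemma next_vertex_less:
  assumes "l < n"
  shows "next_vertex n l < n"
  using assms by (simp add: next_vertex_def)

lemma next_vertex_neq:
  assumes "l < n" "n \<ge> 2"
  shows "next_vertex n l \<noteq> l"
  using assms by (cases "Suc l = n") (auto simp: next_vertex_def)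

lemma next_next_vertex_neq:
  assumes "l < n" "n \<ge> 3"
  shows "next_vertex n (next_vertex n l) \<noteq> l"
  using assms
  by (cases "Suc l = n"; cases "Suc (Suc l) = n") (auto simp: next_vertex_def)

lemma polygon_vertices_distinct:
  assumes "ideal_polygon n p" "k < n" "l < n" "k \<noteq> l"
  shows "p k \<noteq> p l"
  using assms by (auto simp: ideal_polygon_def inj_on_def)

lemma polygon_side_proper:
  assumes "ideal_polygon n p" "n \<ge> 2" "l < n"
  shows "p l \<noteq> p (next_vertex n l)"
  using assms next_vertex_less[of l n] next_vertex_neq[of l n]
  by (intro polygon_vertices_distinct) auto

lemma sum_side_form:
  assumes "I_sum n p + K_sum n p \<noteq> 0"
  shows "(\<Sum>l<n. side_form (p l) (p (next_vertex n l)) X) =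
    - (I_sum n p + K_sum n p) * (1 - hyp_barycenter n p \<bullet> X)"
proof -
  have eq: "- a + B * x + C * y = - a * (1 - (B / a * x + C / a * y))"
    if "a \<noteq> 0" for a B C x y :: real
    using that by (simp add: field_simps)
  have "(\<Sum>l<n. side_form (p l) (p (next_vertex n l)) X) =
      - (I_sum n p + K_sum n p) + (I_sum n p - K_sum n p) * fst X + 2 * J_sum n p * snd X"
    by (simp add: side_form_def I_sum_def J_sum_def K_sum_def sum.distrib sum_negf
        sum_subtractf flip: sum_distrib_right)
  also have "\<dots> = - (I_sum n p + K_sum n p) * (1 - hyp_barycenter n p \<bullet> X)"
    unfolding hyp_barycenter_def inner_prod_def fst_conv snd_conv inner_real_def
    by (rule eq) (rule assms)
  finally show ?thesis .
qed

lemma sum_side_gram: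
  "(\<Sum>k<n. side_gram q r (p k) (p (next_vertex n k))) =
    (I_term q r - K_term q r) * (I_sum n p - K_sum n p) + J_term q r * (2 * J_sum n p)
    - (I_term q r + K_term q r) * (I_sum n p + K_sum n p)"
  by (simp add: side_gram_def I_sum_def J_sum_def K_sum_def sum.distrib
      sum_subtractf sum_distrib_left algebra_simps)

lemma sinh_side_dist:
  assumes "ideal_polygon n p" "n \<ge> 2" "l < n" "norm X < 1"
  shows "sinh (klein_setdist X (side n p l)) =
    \<bar>side_form (p l) (p (next_vertex n l)) X\<bar> / sqrt (1 - (norm X)\<^sup>2)"
proof -
  note pq = polygon_side_proper[OF assms(1-3)]
  note unit = norm_circle_point norm_circle_point circle_point_inj[OF pq]
  show ?thesis
    using sinh_klein_setdist_chord[OF unit assms(4)] inner_less_1[OF unit]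
    unfolding side_def orient_side_form[OF pq] by (simp add: abs_mult)
qed

lemma sinh_signed_side_dist:
  assumes "ideal_polygon n p" "n \<ge> 2" "l < n" "norm X < 1"
  shows "sinh (signed_side_dist n p l X) =
    - sgn (I_sum n p + K_sum n p) * side_form (p l) (p (next_vertex n l)) X
      / sqrt (1 - (norm X)\<^sup>2)"
proof -
  note pq = polygon_side_proper[OF assms(1-3)]
  define f where "f = side_form (p l) (p (next_vertex n l)) X"
  have "sgn (orient (circle_point (p l)) (circle_point (p (next_vertex n l))) X) = sgn f"
    using inner_less_1[OF norm_circle_point norm_circle_point circle_point_inj[OF pq]]
    by (simp add: orient_side_form[OF pq] sgn_mult f_def)
  then have "signed_side_dist n p l X =
      - sgn (I_sum n p + K_sum n p) * sgn f * klein_setdist X (side n p l)"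
    by (simp add: signed_side_dist_def)
  moreover have "sinh (- sgn a * sgn f * d) = - sgn a * sgn f * sinh d" for a d :: real
    by (simp add: sgn_if)
  ultimately show ?thesis
    using sinh_side_dist[OF assms] by (simp add: f_def[symmetric] sgn_mult_abs mult.assoc)
qed

lemma signed_sinh_dist_sum_eq:
  assumes "ideal_polygon n p" "n \<ge> 2" "I_sum n p + K_sum n p \<noteq> 0" "norm X < 1"
  shows "signed_sinh_dist_sum n p X =
    \<bar>I_sum n p + K_sum n p\<bar> * ((1 - hyp_barycenter n p \<bullet> X) / sqrt (1 - (norm X)\<^sup>2))"
proof -
  define a where "a = I_sum n p + K_sum n p"
  have "signed_sinh_dist_sum n p X =
      (\<Sum>l<n. - sgn a * side_form (p l) (p (next_vertex n l)) X / sqrt (1 - (norm X)\<^sup>2))"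
    unfolding signed_sinh_dist_sum_def a_def
    using assms by (intro sum.cong refl sinh_signed_side_dist) auto
  also have "\<dots> = - sgn a * (\<Sum>l<n. side_form (p l) (p (next_vertex n l)) X)
      / sqrt (1 - (norm X)\<^sup>2)"
    by (simp add: sum_distrib_left sum_divide_distrib)
  also have "\<dots> = (sgn a * a) * (1 - hyp_barycenter n p \<bullet> X) / sqrt (1 - (norm X)\<^sup>2)"
    unfolding sum_side_form[OF assms(3), of X, folded a_def] by simp
  also have "sgn a * a = \<bar>a\<bar>" by (simp add: abs_sgn mult.commute)
  finally show ?thesis by (simp add: a_def)
qed

section \<open>Minimality\<close>

text \<open>The left side is the value of the right side at \<open>X = S\<close>.\<close>

lemma reversed_cauchy_schwarz:
  fixes S X :: "'a::real_inner"
  assumes "norm S < 1" "norm X < 1"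
  shows "sqrt (1 - (norm S)\<^sup>2) \<le> (1 - S \<bullet> X) / sqrt (1 - (norm X)\<^sup>2)"
proof -
  have pos: "1 - (norm S)\<^sup>2 > 0" "1 - (norm X)\<^sup>2 > 0"
    using assms by (auto simp: abs_square_less_1)
  have "norm S * norm X \<le> 1" using assms by (simp add: mult_le_one)
  have "sqrt (1 - (norm S)\<^sup>2) * sqrt (1 - (norm X)\<^sup>2) \<le> 1 - norm S * norm X"
    unfolding real_sqrt_mult[symmetric]
  proof (rule real_le_lsqrt)
    show "0 \<le> 1 - norm S * norm X" using \<open>norm S * norm X \<le> 1\<close> by simp
    show "(1 - (norm S)\<^sup>2) * (1 - (norm X)\<^sup>2) \<le> (1 - norm S * norm X)\<^sup>2"
      using zero_le_power2[of "norm S - norm X"] by (simp add: power2_eq_square algebra_simps)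
  qed
  also have "\<dots> \<le> 1 - S \<bullet> X" using norm_cauchy_schwarz[of S X] by simp
  finally show ?thesis using pos by (simp add: field_simps)
qed

lemma signed_sinh_dist_sum_barycenter_le:
  assumes "ideal_polygon n p" "n \<ge> 2" "I_sum n p + K_sum n p \<noteq> 0"
    and S: "norm (hyp_barycenter n p) < 1" and X: "norm X < 1"
  shows "signed_sinh_dist_sum n p (hyp_barycenter n p) \<le> signed_sinh_dist_sum n p X"
proof -
  define S where "S = hyp_barycenter n p"
  have "1 - (norm S)\<^sup>2 > 0" using S by (simp add: S_def abs_square_less_1)
  then have "(1 - S \<bullet> S) / sqrt (1 - (norm S)\<^sup>2) = sqrt (1 - (norm S)\<^sup>2)"
    by (simp add: real_div_sqrt flip: power2_norm_eq_inner)
  also have "\<dots> \<le> (1 - S \<bullet> X) / sqrt (1 - (norm X)\<^sup>2)"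
    using S X by (simp add: S_def reversed_cauchy_schwarz)
  finally show ?thesis
    unfolding signed_sinh_dist_sum_eq[OF assms(1-3) S] signed_sinh_dist_sum_eq[OF assms(1-3) X]
    by (intro mult_left_mono) (auto simp: S_def)
qed

lemma signed_sinh_dist_sum_le:
  assumes "ideal_polygon n p" "n \<ge> 2" "norm X < 1"
  shows "signed_sinh_dist_sum n p X \<le> sinh_dist_sum n p X"
  unfolding signed_sinh_dist_sum_def sinh_dist_sum_def
proof (rule sum_mono)
  fix l assume "l \<in> {..<n}"
  then have l: "l < n" by simp
  show "sinh (signed_side_dist n p l X) \<le> sinh (klein_setdist X (side n p l))"
    unfolding sinh_side_dist[OF assms(1,2) l assms(3)] sinh_signed_side_dist[OF assms(1,2) l assms(3)]
    using assms(3) by (intro divide_right_mono) (auto simp: sgn_if abs_square_le_1)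
qed

section \<open>Convex polygons\<close>

lemma orient_circle_points_rotate:
  "orient (circle_point p) (circle_point q) (circle_point r) =
   orient (circle_point q) (circle_point r) (circle_point p)"
  by (simp add: orient_circle_points)

text \<open>In the definition of convexity, the half-plane that contains the vertices may be chosen on the
  left for some sides and on the right for others. The choice is the same for consecutive sides, since the
  orientation of the triangle that they span is nonzero and decides both.\<close>

lemma convex_polygon_consistent:
  assumes "n \<ge> 3" "ideal_polygon n p" "convex_polygon n p"
  obtains e :: real where "e \<noteq> 0"
    "\<And>l k. l < n \<Longrightarrow> k < n \<Longrightarrow>
      e * orient (circle_point (p l)) (circle_point (p (next_vertex n l))) (circle_point (p k)) \<ge> 0"
proof -
  define h where "h l k =
    orient (circle_point (p l)) (circle_point (p (next_vertex n l))) (circle_point (p k))" for l k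
  have conv: "(\<forall>k<n. 0 \<le> h l k) \<or> (\<forall>k<n. h l k \<le> 0)" if "l < n" for l
    using assms(3) that by (auto simp: convex_polygon_def Let_def h_def)
  define e where "e = h 0 (next_vertex n (next_vertex n 0))"
  have nz: "h l (next_vertex n (next_vertex n l)) \<noteq> 0" if l: "l < n" for l
  proof -
    define m where "m = next_vertex n l"
    have m: "m < n" using next_vertex_less[OF l] by (simp add: m_def)
    have "p l \<noteq> p m" "p m \<noteq> p (next_vertex n m)"
      using polygon_side_proper[OF assms(2)] assms(1) l m by (auto simp: m_def)
    moreover have "p (next_vertex n m) \<noteq> p l"
      using polygon_vertices_distinct[OF assms(2) next_vertex_less[OF m] l]
        next_next_vertex_neq[OF l assms(1)] by (simp add: m_def)
    ultimately show ?thesis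
      by (auto simp: h_def m_def[symmetric] orient_circle_points bracket_nonzero)
  qed
  have sign: "h l (next_vertex n (next_vertex n l)) * h l k \<ge> 0" if "l < n" "k < n" for l k
    using conv[OF that(1)] that next_vertex_less by (meson mult_nonneg_nonneg mult_nonpos_nonpos)
  have "\<forall>k<n. e * h l k \<ge> 0" if "l < n" for l
    using that
  proof (induction l)
    case 0
    then show ?case using sign[of 0] by (simp add: e_def)
  next
    case (Suc l)
    define m where "m = next_vertex n (Suc l)"
    have succ: "next_vertex n l = Suc l" using Suc.prems by (simp add: next_vertex_def)
    have m: "m < n" using next_vertex_less[OF Suc.prems] by (simp add: m_def)
    have eq: "h l m = h (Suc l) l"
      unfolding h_def succ m_def[symmetric] by (rule orient_circle_points_rotate)
    have "h l m \<noteq> 0" using nz[of l] Suc.prems by (simp add: succ m_def)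
    moreover have "e * h l m \<ge> 0" using Suc m by simp
    moreover have "(\<forall>k<n. 0 \<le> h (Suc l) k) \<or> (\<forall>k<n. h (Suc l) k \<le> 0)"
      using conv Suc.prems by simp
    ultimately show ?case
      using eq Suc.prems
      by (smt (verit) Suc_lessD mult_nonneg_nonneg mult_nonpos_nonpos zero_le_mult_iff)
  qed
  then show ?thesis
    using that[of e] nz[of 0] assms(1) by (auto simp: e_def h_def)
qed

text \<open>A normal has product \<open>1\<close> with itself and at most \<open>-1\<close> with each of the other
  \<open>n - 1\<close> normals, so the sum is at most \<open>2 - n\<close>.\<close>

lemma convex_sum_side_gram_neg:
  assumes "n \<ge> 3" "ideal_polygon n p" "convex_polygon n p" "l < n"
  shows "(\<Sum>k<n. side_gram (p l) (p (next_vertex n l)) (p k) (p (next_vertex n k))) < 0"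
proof -
  obtain e :: real where e: "e \<noteq> 0"
    "\<And>l k. l < n \<Longrightarrow> k < n \<Longrightarrow>
      e * orient (circle_point (p l)) (circle_point (p (next_vertex n l))) (circle_point (p k)) \<ge> 0"
    using convex_polygon_consistent[OF assms(1-3)] by blast
  have proper: "p k \<noteq> p (next_vertex n k)" if "k < n" for k
    using polygon_side_proper[OF assms(2)] assms(1) that by simp
  have le: "side_gram (p l) (p (next_vertex n l)) (p k) (p (next_vertex n k)) \<le> - 1"
    if k: "k \<in> {..<n} - {l}" for k
  proof (rule side_gram_le)
    show "p l \<noteq> p (next_vertex n l)" "p k \<noteq> p (next_vertex n k)"
      using proper assms(4) k by auto
    show "p l \<noteq> p k" using polygon_vertices_distinct[OF assms(2,4)] k by auto
    define x where "x = orient (circle_point (p l)) (circle_point (p (next_vertex n l))) (circle_point (p k))"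
    define y where "y = orient (circle_point (p k)) (circle_point (p (next_vertex n k))) (circle_point (p l))"
    have "(e * x) * (e * y) \<ge> 0"
      unfolding x_def y_def using assms(4) k by (intro mult_nonneg_nonneg[OF e(2) e(2)]) auto
    then have "e\<^sup>2 * (x * y) \<ge> 0" by (simp add: power2_eq_square mult_ac)
    then show "x * y \<ge> 0" using e(1) by (simp add: zero_le_mult_iff)
  qed
  have "(\<Sum>k<n. side_gram (p l) (p (next_vertex n l)) (p k) (p (next_vertex n k))) =
      1 + (\<Sum>k\<in>{..<n} - {l}. side_gram (p l) (p (next_vertex n l)) (p k) (p (next_vertex n k)))"
    using assms(4) by (subst sum.remove[of _ l]) (simp_all add: side_gram_self proper)
  also have "\<dots> \<le> 1 + (\<Sum>k\<in>{..<n} - {l}. - 1)"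
    by (intro add_left_mono sum_mono le)
  also have "\<dots> = 2 - real n" using assms(1,4) by (simp add: of_nat_diff)
  finally show ?thesis using assms(1) by simp
qed

text \<open>The double sum over all pairs of sides is the Minkowski square of the sum \<open>V\<close> of the normals.
  It is negative, and the form of \<open>V\<close> has the coefficients \<open>- (I + K)\<close>, \<open>I - K\<close>, \<open>2 * J\<close>.\<close>

lemma convex_barycenter_in_disc:
  assumes "n \<ge> 3" "ideal_polygon n p" "convex_polygon n p"
  shows "I_sum n p + K_sum n p \<noteq> 0" and "norm (hyp_barycenter n p) < 1"
proof -
  define a b c where "a = I_sum n p + K_sum n p" and "b = I_sum n p - K_sum n p"
    and "c = 2 * J_sum n p"
  have "(\<Sum>l<n. \<Sum>k<n. side_gram (p l) (p (next_vertex n l)) (p k) (p (next_vertex n k))) < 0"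
    using assms by (intro sum_strict_mono[where g = "\<lambda>_. 0", simplified] convex_sum_side_gram_neg)
      (auto simp: lessThan_empty_iff)
  also have "(\<Sum>l<n. \<Sum>k<n. side_gram (p l) (p (next_vertex n l)) (p k) (p (next_vertex n k)))
      = b * b + c * c - a * a"
  proof -
    have "(\<Sum>l<n. I_term (p l) (p (next_vertex n l))) = I_sum n p"
      "(\<Sum>l<n. J_term (p l) (p (next_vertex n l))) = c"
      "(\<Sum>l<n. K_term (p l) (p (next_vertex n l))) = K_sum n p"
      by (simp_all add: I_sum_def J_sum_def K_sum_def c_def)
    then show ?thesis
      unfolding sum_side_gram
      by (simp add: sum.distrib sum_subtractf a_def b_def c_def flip: sum_distrib_right)
  qed
  finally have lt: "b\<^sup>2 + c\<^sup>2 < a\<^sup>2" by (simp add: power2_eq_square)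
  then have a: "a \<noteq> 0" using zero_le_power2[of b] zero_le_power2[of c] by (intro notI) simp
  then show "I_sum n p + K_sum n p \<noteq> 0" by (simp add: a_def)
  have "(norm (hyp_barycenter n p))\<^sup>2 = (b\<^sup>2 + c\<^sup>2) / a\<^sup>2"
    by (simp add: hyp_barycenter_def norm_Pair a_def b_def c_def power_divide add_divide_distrib)
  also have "\<dots> < 1" using lt a by simp
  finally show "norm (hyp_barycenter n p) < 1" by (simp add: abs_square_less_1)
qed

text \<open>With this sign, every signed distance of the barycenter is positive: the barycenter lies inside
  the polygon.\<close>

lemma convex_side_form_barycenter:
  assumes "n \<ge> 3" "ideal_polygon n p" "convex_polygon n p" "l < n"
  shows "(I_sum n p + K_sum n p) *
    side_form (p l) (p (next_vertex n l)) (hyp_barycenter n p) < 0"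
proof -
  have eq: "a * (- A + B * (b / a) + C * (c / a)) = B * b + C * c - A * a"
    if "a \<noteq> 0" for a b c A B C :: real
    using that by (simp add: field_simps)
  have "(I_sum n p + K_sum n p) *
      side_form (p l) (p (next_vertex n l)) (hyp_barycenter n p) =
      (\<Sum>k<n. side_gram (p l) (p (next_vertex n l)) (p k) (p (next_vertex n k)))"
    unfolding sum_side_gram side_form_def hyp_barycenter_def fst_conv snd_conv
    by (rule eq) (rule convex_barycenter_in_disc(1)[OF assms(1-3)])
  then show ?thesis using convex_sum_side_gram_neg[OF assms] by simp
qed

lemma convex_sinh_dist_sum_barycenter:
  assumes "n \<ge> 3" "ideal_polygon n p" "convex_polygon n p"
  shows "sinh_dist_sum n p (hyp_barycenter n p) = signed_sinh_dist_sum n p (hyp_barycenter n p)"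
  unfolding signed_sinh_dist_sum_def sinh_dist_sum_def
proof (rule sum.cong[OF refl])
  fix l assume "l \<in> {..<n}"
  then have l: "l < n" by simp
  note S = convex_barycenter_in_disc(2)[OF assms]
  have n: "n \<ge> 2" using assms(1) by simp
  show "sinh (klein_setdist (hyp_barycenter n p) (side n p l)) =
      sinh (signed_side_dist n p l (hyp_barycenter n p))"
    unfolding sinh_side_dist[OF assms(2) n l S] sinh_signed_side_dist[OF assms(2) n l S]
    using convex_side_form_barycenter[OF assms l]
    by (auto simp: mult_less_0_iff)
qed

theorem mainTheorem4:
  fixes n :: nat and p :: "nat \<Rightarrow> real option"
  assumes "n \<ge> 3" and "ideal_polygon n p"
  shows "(convex_polygon n p \<longrightarrow>
            I_sum n p + K_sum n p \<noteq> 0 \<and>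
            is_arg_min (sinh_dist_sum n p) (\<lambda>X. X \<in> klein_disc) (hyp_barycenter n p)) \<and>
         (I_sum n p + K_sum n p \<noteq> 0 \<and> hyp_barycenter n p \<in> klein_disc \<longrightarrow>
            is_arg_min (signed_sinh_dist_sum n p) (\<lambda>X. X \<in> klein_disc) (hyp_barycenter n p))"
proof (intro conjI impI)
  have n: "n \<ge> 2" using assms(1) by simp
  have disc: "X \<in> klein_disc \<longleftrightarrow> norm X < 1" for X
    by (simp add: klein_disc_def)
  {
    assume conv: "convex_polygon n p"
    note S = convex_barycenter_in_disc[OF assms conv]
    show "I_sum n p + K_sum n p \<noteq> 0" by (rule S)
    have "sinh_dist_sum n p (hyp_barycenter n p) \<le> sinh_dist_sum n p X" if "norm X < 1" for X
      using convex_sinh_dist_sum_barycenter[OF assms conv]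
        signed_sinh_dist_sum_barycenter_le[OF assms(2) n S that]
        signed_sinh_dist_sum_le[OF assms(2) n that] by simp
    then show "is_arg_min (sinh_dist_sum n p) (\<lambda>X. X \<in> klein_disc) (hyp_barycenter n p)"
      using S(2) by (auto simp: is_arg_min_linorder disc)
  next
    assume "I_sum n p + K_sum n p \<noteq> 0 \<and> hyp_barycenter n p \<in> klein_disc"
    then show "is_arg_min (signed_sinh_dist_sum n p) (\<lambda>X. X \<in> klein_disc) (hyp_barycenter n p)"
      using signed_sinh_dist_sum_barycenter_le[OF assms(2) n]
      by (auto simp: is_arg_min_linorder disc)
  }
qed

end
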